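(* Let $M^3\subset\mathbb C^2$ be a Levi-nondegenerate $\mathcal C^6$-smooth real hypersurface given as a graph $v=\varphi(z,\overline z,u)$. Let $\mathfrak I$ be the essential complex invariant of its equivalence problem, i.e. the function of $(z,\overline z,u)\in M^3$ and of $\mathsf c\in\mathbb C\setminus\{0\}$ $$\mathfrak I=\frac{1}{\mathsf c\,\overline{\mathsf c}^3}\Big(-\tfrac13\overline{\mathcal L}(\mathcal L(\overline{\mathcal L}(\overline P)))+\tfrac23\mathcal L(\overline{\mathcal L}(\overline P))\,\overline P+\tfrac12\overline{\mathcal L}(\overline{\mathcal L}(\mathcal L(\overline P)))-\tfrac76\overline{\mathcal L}(\mathcal L(\overline P))\,\overline P-\tfrac16\mathcal L(\overline P)\,\overline{\mathcal L}(\overline P)+\tfrac13\mathcal L(\overline P)\,\overline P^2\Big),$$ and let $\mathbf\Delta_1,\mathbf\Delta_4$ be the two essential real invariants of its Cartan geometry (explicit real functions on $M^3$ recalled in the context). Then $$\mathfrak I=\frac{4}{\mathsf c\,\overline{\mathsf c}^3}\big(\mathbf\Delta_1+i\,\mathbf\Delta_4\big).$$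
   Context: Coordinates on $\mathbb C^2$: $(z,w)=(x+iy,u+iv)$. $M^3$ is the graph $v=\varphi(z,\overline z,u)$ of a real-valued $\mathcal C^6$ function $\varphi=z\overline z+\mathrm O(3)$ defined near the origin; $(z,\overline z,u)$ are intrinsic coordinates on $M^3$. Put $$A:=\frac{i\,\varphi_z}{1-i\,\varphi_u},\qquad \ell:=i\big(\overline A_z+A\overline A_u-A_{\overline z}-\overline A A_u\big).$$ $\ell$ is real, and Levi-nondegeneracy means that $\ell$ vanishes nowhere. Define on $M^3$ $$\mathcal L:=\frac{\partial}{\partial z}+A\frac{\partial}{\partial u},\quad \overline{\mathcal L}:=\frac{\partial}{\partial\overline z}+\overline A\frac{\partial}{\partial u},\quad P:=\frac{\ell_z-\ell A_u+A\,\ell_u}{\ell}.$$ Real vector fields $H_1,H_2$ are defined by $\mathcal L=\frac12H_1-\frac i2H_2$, $\overline{\mathcal L}=\frac12H_1+\frac i2H_2$. Put $T:=\frac14[H_1,H_2]$; the real functions $\Phi_1,\Phi_2$ are defined by $[H_1,T]=\Phi_1T$ and $[H_2,T]=\Phi_2T$; one has $P=\frac12\Phi_1-\frac i2\Phi_2$. The two real invariants are $$\begin{aligned}\mathbf\Delta_1=\tfrac1{384}\Big[&H_1(H_1(H_1(\Phi_1)))-H_2(H_2(H_2(\Phi_2)))+11H_1(H_2(H_1(\Phi_2)))-11H_2(H_1(H_2(\Phi_1)))\\&+6\Phi_2H_2(H_1(\Phi_1))-6\Phi_1H_1(H_2(\Phi_2))-3\Phi_2H_1(H_1(\Phi_2))+3\Phi_1H_2(H_2(\Phi_1))\\&-3\Phi_1H_1(H_1(\Phi_1))+3\Phi_2H_2(H_2(\Phi_2))-H_1(\Phi_1)H_1(\Phi_1)+H_2(\Phi_2)H_2(\Phi_2)\\&-2\Phi_2^2H_1(\Phi_1)+2\Phi_1^2H_2(\Phi_2)-2\Phi_2^2H_2(\Phi_2)+2\Phi_1^2H_1(\Phi_1)\Big],\end{aligned}$$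 $$\begin{aligned}\mathbf\Delta_4=\tfrac1{384}\Big[&-3H_2(H_1(H_2(\Phi_2)))-3H_1(H_2(H_1(\Phi_1)))+5H_1(H_2(H_2(\Phi_2)))+5H_2(H_1(H_1(\Phi_1)))\\&+4\Phi_1H_1(H_1(\Phi_2))+4\Phi_2H_2(H_1(\Phi_2))-3\Phi_2H_1(H_1(\Phi_1))-3\Phi_1H_2(H_2(\Phi_2))\\&-7\Phi_2H_1(H_2(\Phi_2))-7\Phi_1H_2(H_1(\Phi_1))-2H_1(\Phi_1)H_1(\Phi_2)-2H_2(\Phi_2)H_2(\Phi_1)\\&+4\Phi_1\Phi_2H_1(\Phi_1)+4\Phi_1\Phi_2H_2(\Phi_2)\Big].\end{aligned}$$ *)

theory Defs
  imports "HOL-Analysis.Analysis" "HOL-Library.Landau_Symbols"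
begin

text \<open>
  The hypersurface \<open>v = \<phi>(z, u)\<close> in \<open>\<complex>\<^sup>2\<close>, where \<open>\<phi>\<close> is a real function of the real variables
  \<open>x, y, u\<close>, is handled in its intrinsic coordinates: the point with parameters \<open>z = x + i y\<close> and
  \<open>u\<close> is the pair \<open>(z, u)\<close> of type \<^typ>\<open>complex \<times> real\<close>, a real vector
  space of dimension 3. Tangent vectors of the graph are elements of the same space, so that
  \<open>(1, 0)\<close>, \<open>(\<i>, 0)\<close>, \<open>(0, 1)\<close> are \<open>\<partial>/\<partial>x\<close>, \<open>\<partial>/\<partial>y\<close>, \<open>\<partial>/\<partial>u\<close>.
\<close>

subsection \<open>Functions of class \<open>C\<^sup>k\<close>, vector fields, Lie brackets\<close>

text \<open>Only meaningful for open \<open>S\<close>.\<close>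

fun Ck_on :: "nat \<Rightarrow> ('a::real_normed_vector \<Rightarrow> 'b::real_normed_vector) \<Rightarrow> 'a set \<Rightarrow> bool" where
  "Ck_on 0 f S \<longleftrightarrow> continuous_on S f"
| "Ck_on (Suc k) f S \<longleftrightarrow> (\<forall>p\<in>S. f differentiable (at p)) \<and>
     (\<forall>v. Ck_on k (\<lambda>p. frechet_derivative f (at p) v) S)"

definition vf_apply :: "('a::real_normed_vector \<Rightarrow> 'a) \<Rightarrow> ('a \<Rightarrow> 'b::real_normed_vector) \<Rightarrow> 'a \<Rightarrow> 'b"
  where "vf_apply X f p = frechet_derivative f (at p) (X p)"

definition lie_bracket :: "('a::real_normed_vector \<Rightarrow> 'a) \<Rightarrow> ('a \<Rightarrow> 'a) \<Rightarrow> 'a \<Rightarrow> 'a"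
  where "lie_bracket X Y p = vf_apply X Y p - vf_apply Y X p"

subsection \<open>Wirtinger and \<open>u\<close>-derivatives\<close>

definition d_z :: "(complex \<times> real \<Rightarrow> complex) \<Rightarrow> complex \<times> real \<Rightarrow> complex" where
  "d_z f p = (1/2) * (frechet_derivative f (at p) (1, 0) - \<i> * frechet_derivative f (at p) (\<i>, 0))"

definition d_zbar :: "(complex \<times> real \<Rightarrow> complex) \<Rightarrow> complex \<times> real \<Rightarrow> complex" where
  "d_zbar f p = (1/2) * (frechet_derivative f (at p) (1, 0) + \<i> * frechet_derivative f (at p) (\<i>, 0))"

definition d_u :: "(complex \<times> real \<Rightarrow> complex) \<Rightarrow> complex \<times> real \<Rightarrow> complex" where
  "d_u f p = frechet_derivative f (at p) (0, 1)"

subsection \<open>The CR structure of the graph\<close>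

definition coef_A :: "(complex \<times> real \<Rightarrow> real) \<Rightarrow> complex \<times> real \<Rightarrow> complex" where
  "coef_A \<phi> p = \<i> * d_z (\<lambda>q. of_real (\<phi> q)) p / (1 - \<i> * d_u (\<lambda>q. of_real (\<phi> q)) p)"

definition coef_Abar :: "(complex \<times> real \<Rightarrow> real) \<Rightarrow> complex \<times> real \<Rightarrow> complex" where
  "coef_Abar \<phi> p = cnj (coef_A \<phi> p)"

definition L :: "(complex \<times> real \<Rightarrow> real) \<Rightarrow> (complex \<times> real \<Rightarrow> complex) \<Rightarrow> complex \<times> real \<Rightarrow> complex"
  where "L \<phi> f p = d_z f p + coef_A \<phi> p * d_u f p"

definition Lbar :: "(complex \<times> real \<Rightarrow> real) \<Rightarrow> (complex \<times> real \<Rightarrow> complex) \<Rightarrow> complex \<times> real \<Rightarrow> complex"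
  where "Lbar \<phi> f p = d_zbar f p + coef_Abar \<phi> p * d_u f p"

definition levi :: "(complex \<times> real \<Rightarrow> real) \<Rightarrow> complex \<times> real \<Rightarrow> complex" where
  "levi \<phi> p = \<i> * (d_z (coef_Abar \<phi>) p + coef_A \<phi> p * d_u (coef_Abar \<phi>) p
                  - d_zbar (coef_A \<phi>) p - coef_Abar \<phi> p * d_u (coef_A \<phi>) p)"

definition levi_nondegenerate_on :: "(complex \<times> real) set \<Rightarrow> (complex \<times> real \<Rightarrow> real) \<Rightarrow> bool" where
  "levi_nondegenerate_on U \<phi> \<longleftrightarrow> (\<forall>p\<in>U. levi \<phi> p \<noteq> 0)"

definition coef_P :: "(complex \<times> real \<Rightarrow> real) \<Rightarrow> complex \<times> real \<Rightarrow> complex" where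
  "coef_P \<phi> p = (d_z (levi \<phi>) p - levi \<phi> p * d_u (coef_A \<phi>) p + coef_A \<phi> p * d_u (levi \<phi>) p)
                / levi \<phi> p"

definition coef_Pbar :: "(complex \<times> real \<Rightarrow> real) \<Rightarrow> complex \<times> real \<Rightarrow> complex" where
  "coef_Pbar \<phi> p = cnj (coef_P \<phi> p)"

definition complex_invariant ::
    "(complex \<times> real \<Rightarrow> real) \<Rightarrow> complex \<times> real \<Rightarrow> complex \<Rightarrow> complex" where
  "complex_invariant \<phi> p c =
    (let D = L \<phi>; D' = Lbar \<phi>; Q = coef_Pbar \<phi> in
      1 / (c * cnj c ^ 3) *
      ( - (1/3) * D' (D (D' Q)) p
        + (2/3) * D (D' Q) p * Q p
        + (1/2) * D' (D' (D Q)) p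
        - (7/6) * D' (D Q) p * Q p
        - (1/6) * D Q p * D' Q p
        + (1/3) * D Q p * (Q p)^2))"

subsection \<open>The real frame\<close>

text \<open>
  \<open>H1\<close> and \<open>H2\<close> are the real vector fields with \<open>L = H1/2 - (\<i>/2) H2\<close> and \<open>Lbar = H1/2 + (\<i>/2) H2\<close>,
  written out as \<open>H1 = L + Lbar\<close> and \<open>H2 = \<i> (L - Lbar)\<close> in the frame \<open>\<partial>/\<partial>x, \<partial>/\<partial>y, \<partial>/\<partial>u\<close>. Lemma
  \<open>real_frame_iff\<close> below shows that the two equations characterise them.
\<close>

definition H1 :: "(complex \<times> real \<Rightarrow> real) \<Rightarrow> complex \<times> real \<Rightarrow> complex \<times> real" where
  "H1 \<phi> p = (1, 2 * Re (coef_A \<phi> p))"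

definition H2 :: "(complex \<times> real \<Rightarrow> real) \<Rightarrow> complex \<times> real \<Rightarrow> complex \<times> real" where
  "H2 \<phi> p = (\<i>, - 2 * Im (coef_A \<phi> p))"

lemma real_frame_iff:
  "(\<forall>f. f differentiable (at p) \<longrightarrow>
      L \<phi> f p = (1/2) * vf_apply X f p - (\<i>/2) * vf_apply Y f p \<and>
      Lbar \<phi> f p = (1/2) * vf_apply X f p + (\<i>/2) * vf_apply Y f p)
   \<longleftrightarrow> X p = H1 \<phi> p \<and> Y p = H2 \<phi> p" (is "?lhs \<longleftrightarrow> ?rhs")
proof
  assume ?rhs
  then have X: "X p = H1 \<phi> p" and Y: "Y p = H2 \<phi> p" by auto
  show ?lhs
  proof (intro allI impI)
    fix f :: "complex \<times> real \<Rightarrow> complex"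
    assume "f differentiable (at p)"
    then interpret D: bounded_linear "frechet_derivative f (at p)"
      using frechet_derivative_works has_derivative_bounded_linear by blast
    define a where "a = coef_A \<phi> p"
    define F where "F = frechet_derivative f (at p)"
    have 1: "F (1, 2 * Re a) = F (1, 0) + (2 * Re a) *\<^sub>R F (0, 1)"
      unfolding F_def D.scaleR[symmetric] D.add[symmetric] by simp
    have 2: "F (\<i>, - 2 * Im a) = F (\<i>, 0) + (- 2 * Im a) *\<^sub>R F (0, 1)"
      unfolding F_def D.scaleR[symmetric] D.add[symmetric] by simp
    show "L \<phi> f p = (1/2) * vf_apply X f p - (\<i>/2) * vf_apply Y f p \<and>
      Lbar \<phi> f p = (1/2) * vf_apply X f p + (\<i>/2) * vf_apply Y f p"
      unfolding L_def Lbar_def d_z_def d_zbar_def d_u_def coef_Abar_def vf_apply_def X Y H1_def H2_def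
        a_def[symmetric] F_def[symmetric] 1 2
      by (simp add: complex_eq_iff algebra_simps)
  qed
next
  assume lhs: ?lhs
  have fd: "frechet_derivative g (at p) = g" if "bounded_linear g"
    for g :: "complex \<times> real \<Rightarrow> complex"
    by (metis bounded_linear_imp_has_derivative frechet_derivative_at that)
  have b: "bounded_linear (fst :: complex \<times> real \<Rightarrow> complex)"
    "bounded_linear (\<lambda>q :: complex \<times> real. complex_of_real (snd q))"
    by (auto intro: bounded_linear_fst bounded_linear_snd
        bounded_linear_compose[OF bounded_linear_of_real])
  note d = bounded_linear_imp_differentiable[OF b(1)] bounded_linear_imp_differentiable[OF b(2)]
  from lhs[rule_format, OF d(1)] lhs[rule_format, OF d(2)]
  show ?rhs
    by (auto simp: L_def Lbar_def d_z_def d_zbar_def d_u_def vf_apply_def fd[OF b(1)] fd[OF b(2)]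
        H1_def H2_def coef_Abar_def prod_eq_iff complex_eq_iff)
qed

definition T :: "(complex \<times> real \<Rightarrow> real) \<Rightarrow> complex \<times> real \<Rightarrow> complex \<times> real" where
  "T \<phi> p = (1/4) *\<^sub>R lie_bracket (H1 \<phi>) (H2 \<phi>) p"

text \<open>
  \<open>T = -(\<ell>/2) \<partial>/\<partial>u\<close> does not vanish where the Levi form is nondegenerate, and the brackets
  \<open>[H1, T]\<close>, \<open>[H2, T]\<close> are multiples of \<open>\<partial>/\<partial>u\<close>; hence the descriptions below are proper there.
\<close>

definition Phi1 :: "(complex \<times> real \<Rightarrow> real) \<Rightarrow> complex \<times> real \<Rightarrow> real" where
  "Phi1 \<phi> p = (THE r. lie_bracket (H1 \<phi>) (T \<phi>) p = r *\<^sub>R T \<phi> p)"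

definition Phi2 :: "(complex \<times> real \<Rightarrow> real) \<Rightarrow> complex \<times> real \<Rightarrow> real" where
  "Phi2 \<phi> p = (THE r. lie_bracket (H2 \<phi>) (T \<phi>) p = r *\<^sub>R T \<phi> p)"

definition Delta1 :: "(complex \<times> real \<Rightarrow> real) \<Rightarrow> complex \<times> real \<Rightarrow> real" where
  "Delta1 \<phi> p =
    (let h = vf_apply (H1 \<phi>); k = vf_apply (H2 \<phi>); F = Phi1 \<phi>; G = Phi2 \<phi> in
      1/384 *
      ( h (h (h F)) p - k (k (k G)) p + 11 * h (k (h G)) p - 11 * k (h (k F)) p
        + 6 * G p * k (h F) p - 6 * F p * h (k G) p - 3 * G p * h (h G) p + 3 * F p * k (k F) p
        - 3 * F p * h (h F) p + 3 * G p * k (k G) p - h F p * h F p + k G p * k G p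
        - 2 * (G p)^2 * h F p + 2 * (F p)^2 * k G p - 2 * (G p)^2 * k G p + 2 * (F p)^2 * h F p))"

definition Delta4 :: "(complex \<times> real \<Rightarrow> real) \<Rightarrow> complex \<times> real \<Rightarrow> real" where
  "Delta4 \<phi> p =
    (let h = vf_apply (H1 \<phi>); k = vf_apply (H2 \<phi>); F = Phi1 \<phi>; G = Phi2 \<phi> in
      1/384 *
      ( - 3 * k (h (k G)) p - 3 * h (k (h F)) p + 5 * h (k (k G)) p + 5 * k (h (h F)) p
        + 4 * F p * h (h G) p + 4 * G p * k (h G) p - 3 * G p * h (h F) p - 3 * F p * k (k G) p
        - 7 * G p * h (k G) p - 7 * F p * k (h F) p - 2 * h F p * h G p - 2 * k G p * k F p
        + 4 * F p * G p * h F p + 4 * F p * G p * k G p))"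

end

theory Submission
  imports Defs
begin

text \<open>
  Write \<open>X, Y, F, G\<close> for \<open>H1, H2, Phi1, Phi2\<close>. From \<open>T = -(\<ell>/2) \<partial>/\<partial>u\<close> one computes
  \<open>P = (F - \<i> G)/2\<close>, so both sides of the theorem are polynomials in iterated derivatives of
  \<open>F\<close> and \<open>G\<close> along \<open>X\<close> and \<open>Y\<close>. The derivatives of \<open>F\<close> and \<open>G\<close> are not independent:
  the Jacobi identity for \<open>X, Y, T\<close> gives \<open>X G = Y F\<close>, and the brackets \<open>[X, [X, Y]] = F [X, Y]\<close>,
  \<open>[Y, [X, Y]] = G [X, Y]\<close> applied to \<open>F\<close> and \<open>G\<close> give four third-order relations. Modulo
  \<open>X G = Y F\<close> and its derivatives, the claim is a linear consequence of these four relations.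
\<close>

section \<open>Functions of class \<open>C\<^sup>k\<close>\<close>

lemma has_derivative_cong_open:
  assumes "open S" "p \<in> S" "\<And>q. q \<in> S \<Longrightarrow> f q = g q"
  shows "(f has_derivative D) (at p) \<longleftrightarrow> (g has_derivative D) (at p)"
proof
  show "(g has_derivative D) (at p)" if "(f has_derivative D) (at p)"
    by (rule has_derivative_transform_within_open[OF that assms(1,2)]) (rule assms(3))
  show "(f has_derivative D) (at p)" if "(g has_derivative D) (at p)"
    by (rule has_derivative_transform_within_open[OF that assms(1,2)]) (simp add: assms(3))
qed

lemma frechet_derivative_cong_open:
  assumes "open S" "p \<in> S" "\<And>q. q \<in> S \<Longrightarrow> f q = g q"
  shows "frechet_derivative f (at p) = frechet_derivative g (at p)"
  unfolding frechet_derivative_def by (simp add: has_derivative_cong_open[where f=f and g=g, OF assms])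

lemma differentiable_cong_open:
  assumes "open S" "p \<in> S" "\<And>q. q \<in> S \<Longrightarrow> f q = g q"
  shows "f differentiable (at p) \<longleftrightarrow> g differentiable (at p)"
  unfolding differentiable_def by (simp add: has_derivative_cong_open[where f=f and g=g, OF assms])

lemma vf_apply_cong_open:
  assumes "open S" "p \<in> S" "\<And>q. q \<in> S \<Longrightarrow> f q = g q"
  shows "vf_apply X f p = vf_apply X g p"
  unfolding vf_apply_def using frechet_derivative_cong_open[OF assms] by simp

text \<open>On an open set the derivative at a point depends only on nearby values, so equality on
  \<open>S\<close> passes to derivatives of every order. The closure lemmas below all use this:
  compute the derivative pointwise on \<open>S\<close>, then replace
  \<open>frechet_derivative\<close> by that formula.\<close>

lemma Ck_on_cong:
  assumes "open S" "\<And>q. q \<in> S \<Longrightarrow> f q = g q" "Ck_on k f S"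
  shows "Ck_on k g S"
  using assms(2,3)
proof (induction k arbitrary: f g)
  case 0
  then show ?case by (simp cong: continuous_on_cong)
next
  case (Suc k)
  have "Ck_on k (\<lambda>p. frechet_derivative g (at p) v) S" for v
  proof (rule Suc.IH)
    show "Ck_on k (\<lambda>p. frechet_derivative f (at p) v) S"
      using Suc.prems(2) by simp
  qed (rule fun_cong[OF frechet_derivative_cong_open[OF assms(1)]], simp_all add: Suc.prems(1))
  moreover have "g differentiable (at p)" if "p \<in> S" for p
    using Suc.prems(2) differentiable_cong_open[where f=f and g=g, OF assms(1) that] Suc.prems(1) that by simp
  ultimately show ?case by simp
qed

lemma Ck_on_Suc_differentiable: "Ck_on (Suc k) f S \<Longrightarrow> p \<in> S \<Longrightarrow> f differentiable (at p)"
  by simp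

lemma Ck_on_frechet_derivative:
  "Ck_on (Suc k) f S \<Longrightarrow> Ck_on k (\<lambda>p. frechet_derivative f (at p) v) S"
  by simp

lemma Ck_on_Suc_mono: "Ck_on (Suc k) f S \<Longrightarrow> Ck_on k f S"
proof (induction k arbitrary: f)
  case 0
  then show ?case
    by (auto intro!: continuous_at_imp_continuous_on differentiable_imp_continuous_within)
next
  case (Suc k)
  have "f differentiable (at p)" if "p \<in> S" for p
    using Suc.prems that by (subst (asm) Ck_on.simps(2)) blast
  moreover have "Ck_on k (\<lambda>p. frechet_derivative f (at p) v) S" for v
    using Suc.prems by (subst (asm) Ck_on.simps(2)) (blast intro: Suc.IH)
  ultimately show ?case by simp
qed

lemma Ck_on_mono:
  assumes "Ck_on m f S" "k \<le> m"
  shows "Ck_on k f S"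
  using assms(2,1) by (rule inc_induct) (rule Ck_on_Suc_mono)

lemma Ck_on_differentiable: "Ck_on k f S \<Longrightarrow> 0 < k \<Longrightarrow> p \<in> S \<Longrightarrow> f differentiable (at p)"
  by (cases k) auto

lemma has_derivative_frechet:
  "f differentiable (at p) \<Longrightarrow> (f has_derivative frechet_derivative f (at p)) (at p)"
  by (simp add: frechet_derivative_works)

lemma frechet_derivative_eqI: "(f has_derivative D) (at p) \<Longrightarrow> frechet_derivative f (at p) = D"
  using frechet_derivative_at by metis

section \<open>Closure of the class C^k under linear maps, sums, products and quotients\<close>

lemma Ck_on_const: "Ck_on k (\<lambda>p. c) S"
  by (induction k arbitrary: c) auto

lemma Ck_on_bounded_linear:
  assumes "open S" "bounded_linear h" "Ck_on k f S"
  shows "Ck_on k (\<lambda>p. h (f p)) S"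
  using assms(3)
proof (induction k arbitrary: f)
  case 0
  then show ?case
    by (simp add: bounded_linear.continuous_on[OF assms(2)])
next
  case (Suc k)
  have d: "((\<lambda>p. h (f p)) has_derivative (\<lambda>v. h (frechet_derivative f (at p) v))) (at p)"
    if "p \<in> S" for p
    using Suc.prems that
    by (intro bounded_linear.has_derivative[OF assms(2)] has_derivative_frechet) auto
  have "Ck_on k (\<lambda>p. frechet_derivative (\<lambda>p. h (f p)) (at p) v) S" for v
    using Suc.prems frechet_derivative_eqI[OF d]
    by (intro Ck_on_cong[OF assms(1) _ Suc.IH]) auto
  moreover have "\<forall>p\<in>S. (\<lambda>p. h (f p)) differentiable (at p)"
    using differentiableI[OF d] by blast
  ultimately show ?case by simp
qed

lemma Ck_on_add:
  assumes "open S" "Ck_on k f S" "Ck_on k g S"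
  shows "Ck_on k (\<lambda>p. f p + g p) S"
  using assms(2,3)
proof (induction k arbitrary: f g)
  case 0
  then show ?case by (simp add: continuous_on_add)
next
  case (Suc k)
  have d: "((\<lambda>p. f p + g p) has_derivative
      (\<lambda>v. frechet_derivative f (at p) v + frechet_derivative g (at p) v)) (at p)"
    if "p \<in> S" for p
    using Suc.prems that by (intro has_derivative_add has_derivative_frechet) auto
  have "Ck_on k (\<lambda>p. frechet_derivative (\<lambda>p. f p + g p) (at p) v) S" for v
  proof (rule Ck_on_cong[OF assms(1)])
    show "Ck_on k (\<lambda>p. frechet_derivative f (at p) v + frechet_derivative g (at p) v) S"
      using Suc.prems by (intro Suc.IH) simp_all
  qed (simp add: frechet_derivative_eqI[OF d])
  moreover have "\<forall>p\<in>S. (\<lambda>p. f p + g p) differentiable (at p)"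
    using differentiableI[OF d] by blast
  ultimately show ?case by simp
qed

lemma Ck_on_bounded_bilinear:
  assumes "open S" "bounded_bilinear h" "Ck_on k f S" "Ck_on k g S"
  shows "Ck_on k (\<lambda>p. h (f p) (g p)) S"
  using assms(3,4)
proof (induction k arbitrary: f g)
  case 0
  then show ?case
    by (simp add: bounded_bilinear.continuous_on[OF assms(2)])
next
  case (Suc k)
  have d: "((\<lambda>p. h (f p) (g p)) has_derivative
      (\<lambda>v. h (f p) (frechet_derivative g (at p) v) + h (frechet_derivative f (at p) v) (g p))) (at p)"
    if "p \<in> S" for p
    using Suc.prems that
    by (intro bounded_bilinear.FDERIV[OF assms(2)] has_derivative_frechet) auto
  have "Ck_on k (\<lambda>p. frechet_derivative (\<lambda>p. h (f p) (g p)) (at p) v) S" for v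
  proof (rule Ck_on_cong[OF assms(1)])
    show "Ck_on k (\<lambda>p. h (f p) (frechet_derivative g (at p) v) +
        h (frechet_derivative f (at p) v) (g p)) S"
      \<comment> \<open>The product rule leaves one factor undifferentiated; lowering its class by
        one makes the induction hypothesis fit both terms.\<close>
      using Suc.prems Suc.prems[THEN Ck_on_Suc_mono] by (intro Ck_on_add Suc.IH assms(1)) simp_all
  qed (simp add: frechet_derivative_eqI[OF d])
  moreover have "\<forall>p\<in>S. (\<lambda>p. h (f p) (g p)) differentiable (at p)"
    using differentiableI[OF d] by blast
  ultimately show ?case by simp
qed

lemmas Ck_on_mult = Ck_on_bounded_bilinear[OF _ bounded_bilinear_mult]
lemmas Ck_on_scaleR = Ck_on_bounded_bilinear[OF _ bounded_bilinear_scaleR]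

lemma Ck_on_diff:
  assumes "open S" "Ck_on k f S" "Ck_on k g S"
  shows "Ck_on k (\<lambda>p. f p - g p) S"
  using Ck_on_add[OF assms(1,2) Ck_on_bounded_linear[OF assms(1) bounded_linear_minus[OF bounded_linear_ident] assms(3)]]
  by simp

lemma Ck_on_sum:
  assumes "open S" "\<And>i. i \<in> I \<Longrightarrow> Ck_on k (f i) S"
  shows "Ck_on k (\<lambda>p. \<Sum>i\<in>I. f i p) S"
  using assms(2)
proof (induction I rule: infinite_finite_induct)
  case (insert i I)
  then show ?case using Ck_on_add[OF assms(1), of k "f i" "\<lambda>p. \<Sum>i\<in>I. f i p"] by simp
qed (auto simp: Ck_on_const)

lemma Ck_on_inverse:
  fixes f :: "'a::real_normed_vector \<Rightarrow> 'b::real_normed_field"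
  assumes "open S" "Ck_on k f S" "\<And>p. p \<in> S \<Longrightarrow> f p \<noteq> 0"
  shows "Ck_on k (\<lambda>p. inverse (f p)) S"
  using assms(2)
proof (induction k)
  case 0
  then show ?case using assms(3) by (simp add: continuous_on_inverse)
next
  case (Suc k)
  have d: "((\<lambda>p. inverse (f p)) has_derivative
      (\<lambda>v. - (inverse (f p) * frechet_derivative f (at p) v * inverse (f p)))) (at p)"
    if "p \<in> S" for p
    using Suc.prems that assms(3)
    by (intro Deriv.has_derivative_inverse has_derivative_frechet) auto
  \<comment> \<open>The derivative of the inverse contains the inverse again, now only to order
    \<open>k\<close>, where the induction hypothesis supplies it.\<close>
  have k: "Ck_on k (\<lambda>p. inverse (f p)) S"
    by (rule Suc.IH[OF Ck_on_Suc_mono[OF Suc.prems]])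
  have "Ck_on k (\<lambda>p. frechet_derivative (\<lambda>p. inverse (f p)) (at p) v) S" for v
  proof (rule Ck_on_cong[OF assms(1)])
    show "Ck_on k (\<lambda>p. 0 - (inverse (f p) * frechet_derivative f (at p) v * inverse (f p))) S"
      using Suc.prems k by (intro Ck_on_diff Ck_on_mult Ck_on_const assms(1)) auto
  qed (simp add: frechet_derivative_eqI[OF d])
  moreover have "\<forall>p\<in>S. (\<lambda>p. inverse (f p)) differentiable (at p)"
    using differentiableI[OF d] by blast
  ultimately show ?case by simp
qed

lemma Ck_on_divide:
  fixes f g :: "'a::real_normed_vector \<Rightarrow> 'b::real_normed_field"
  assumes "open S" "Ck_on k f S" "Ck_on k g S" "\<And>p. p \<in> S \<Longrightarrow> g p \<noteq> 0"
  shows "Ck_on k (\<lambda>p. f p / g p) S"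
  using Ck_on_mult[OF assms(1,2) Ck_on_inverse[OF assms(1,3,4)]] by (simp add: divide_inverse)

section \<open>Symmetry of second derivatives\<close>

text \<open>The mean value theorem is used twice: along \<open>v\<close>, for the difference of
  \<open>f\<close> between two opposite edges of the parallelogram, and then along \<open>w\<close>,
  for the derivative of \<open>f\<close> in direction \<open>v\<close>.\<close>

lemma second_difference:
  fixes f :: "'a::real_normed_vector \<Rightarrow> real"
  assumes r: "0 < r"
    and S: "\<And>s t. 0 \<le> s \<Longrightarrow> s \<le> r \<Longrightarrow> 0 \<le> t \<Longrightarrow> t \<le> r \<Longrightarrow> p + s *\<^sub>R v + t *\<^sub>R w \<in> S"
    and f: "\<And>q. q \<in> S \<Longrightarrow> f differentiable (at q)"
    and fv: "\<And>q. q \<in> S \<Longrightarrow> (\<lambda>q. frechet_derivative f (at q) v) differentiable (at q)"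
  obtains s t where "0 < s" "s < r" "0 < t" "t < r"
    "f (p + r *\<^sub>R v + r *\<^sub>R w) - f (p + r *\<^sub>R v) - (f (p + r *\<^sub>R w) - f p) =
     r * (r * frechet_derivative (\<lambda>q. frechet_derivative f (at q) v) (at (p + s *\<^sub>R v + t *\<^sub>R w)) w)"
proof -
  define D where "D = (\<lambda>q. frechet_derivative f (at q) v)"
  have lin: "linear (frechet_derivative f (at q))" if "q \<in> S" for q
    by (rule linear_frechet_derivative[OF f[OF that]])
  have d1: "((\<lambda>s. f (p + s *\<^sub>R v + t *\<^sub>R w)) has_derivative (\<lambda>y. y * D (p + s *\<^sub>R v + t *\<^sub>R w))) (at s)"
    if "0 \<le> s" "s \<le> r" "0 \<le> t" "t \<le> r" for s t
  proof -
    have "((\<lambda>s. f (p + s *\<^sub>R v + t *\<^sub>R w)) has_derivative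
        (\<lambda>y. frechet_derivative f (at (p + s *\<^sub>R v + t *\<^sub>R w)) (y *\<^sub>R v))) (at s)"
      by (rule has_derivative_compose[where f="\<lambda>s. p + s *\<^sub>R v + t *\<^sub>R w",
            OF _ has_derivative_frechet[OF f[OF S[OF that]]]])
        (auto intro!: derivative_eq_intros)
    then show ?thesis
      unfolding D_def using linear_scale[OF lin[OF S[OF that]]] by simp
  qed
  have d2: "((\<lambda>t. D (p + s *\<^sub>R v + t *\<^sub>R w)) has_derivative
      (\<lambda>y. y * frechet_derivative D (at (p + s *\<^sub>R v + t *\<^sub>R w)) w)) (at t)"
    if "0 \<le> s" "s \<le> r" "0 \<le> t" "t \<le> r" for s t
  proof -
    have D: "D differentiable (at (p + s *\<^sub>R v + t *\<^sub>R w))"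
      unfolding D_def by (rule fv[OF S[OF that]])
    have "((\<lambda>t. D (p + s *\<^sub>R v + t *\<^sub>R w)) has_derivative
        (\<lambda>y. frechet_derivative D (at (p + s *\<^sub>R v + t *\<^sub>R w)) (y *\<^sub>R w))) (at t)"
      by (rule has_derivative_compose[where f="\<lambda>t. p + s *\<^sub>R v + t *\<^sub>R w",
            OF _ has_derivative_frechet[OF D]])
        (auto intro!: derivative_eq_intros)
    then show ?thesis
      using linear_scale[OF linear_frechet_derivative[OF D]] by simp
  qed
  have "((\<lambda>s. f (p + s *\<^sub>R v + r *\<^sub>R w) - f (p + s *\<^sub>R v + 0 *\<^sub>R w)) has_derivative
      (\<lambda>y. y * D (p + s *\<^sub>R v + r *\<^sub>R w) - y * D (p + s *\<^sub>R v + 0 *\<^sub>R w))) (at s within {0..r})"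
    if "0 \<le> s" "s \<le> r" for s
    by (rule has_derivative_at_withinI[OF has_derivative_diff[OF d1[of s r] d1[of s 0]]]) (use that r in auto)
  from mvt_simple[where f="\<lambda>s. f (p + s *\<^sub>R v + r *\<^sub>R w) - f (p + s *\<^sub>R v + 0 *\<^sub>R w)"
      and f'="\<lambda>s y. y * D (p + s *\<^sub>R v + r *\<^sub>R w) - y * D (p + s *\<^sub>R v + 0 *\<^sub>R w)", OF r this]
  obtain s where s: "s \<in> {0<..<r}"
    "(f (p + r *\<^sub>R v + r *\<^sub>R w) - f (p + r *\<^sub>R v + 0 *\<^sub>R w)) - (f (p + 0 *\<^sub>R v + r *\<^sub>R w) - f (p + 0 *\<^sub>R v + 0 *\<^sub>R w))
      = (r - 0) * D (p + s *\<^sub>R v + r *\<^sub>R w) - (r - 0) * D (p + s *\<^sub>R v + 0 *\<^sub>R w)"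
    by blast
  have "((\<lambda>t. D (p + s *\<^sub>R v + t *\<^sub>R w)) has_derivative
      (\<lambda>y. y * frechet_derivative D (at (p + s *\<^sub>R v + t *\<^sub>R w)) w)) (at t within {0..r})"
    if "0 \<le> t" "t \<le> r" for t
    by (rule has_derivative_at_withinI[OF d2]) (use that s(1) in auto)
  from mvt_simple[where f="\<lambda>t. D (p + s *\<^sub>R v + t *\<^sub>R w)"
      and f'="\<lambda>t y. y * frechet_derivative D (at (p + s *\<^sub>R v + t *\<^sub>R w)) w", OF r this]
  obtain t where t: "t \<in> {0<..<r}"
    "D (p + s *\<^sub>R v + r *\<^sub>R w) - D (p + s *\<^sub>R v + 0 *\<^sub>R w)
      = (r - 0) * frechet_derivative D (at (p + s *\<^sub>R v + t *\<^sub>R w)) w"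
    by blast
  show ?thesis
    by (rule that[of s t]) (use s t in \<open>auto simp: D_def right_diff_distrib[symmetric]\<close>)
qed

text \<open>The second difference over a small parallelogram is symmetric in \<open>v\<close> and
  \<open>w\<close>. By \<open>second_difference\<close> it is \<open>r * r\<close> times either
  mixed derivative at some point nearby, and continuity of both at \<open>p\<close> forces them to
  agree there.\<close>

lemma frechet_derivative_commute:
  fixes f :: "'a::real_normed_vector \<Rightarrow> real"
  assumes "open S" "p \<in> S" "Ck_on 2 f S"
  shows "frechet_derivative (\<lambda>q. frechet_derivative f (at q) v) (at p) w =
         frechet_derivative (\<lambda>q. frechet_derivative f (at q) w) (at p) v"
    (is "?E p = ?G p")
proof -
  have f: "f differentiable (at q)" if "q \<in> S" for q
    using assms(3) that by (auto simp: numeral_2_eq_2)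
  have fv: "(\<lambda>q. frechet_derivative f (at q) v) differentiable (at q)" if "q \<in> S" for v q
    using assms(3) that by (auto simp: numeral_2_eq_2)
  have cont: "continuous_on S ?E" "continuous_on S ?G"
    using assms(3) by (auto simp: numeral_2_eq_2)
  have "\<bar>?E p - ?G p\<bar> \<le> e" if "e > 0" for e
  proof -
    have "eventually (\<lambda>q. \<bar>?E q - ?E p\<bar> < e / 2 \<and> \<bar>?G q - ?G p\<bar> < e / 2 \<and> q \<in> S) (nhds p)"
    proof (intro eventually_conj)
      have "isCont ?E p" "isCont ?G p"
        using cont assms(1,2) by (auto simp: continuous_on_eq_continuous_at)
      then show "eventually (\<lambda>q. \<bar>?E q - ?E p\<bar> < e / 2) (nhds p)"
        "eventually (\<lambda>q. \<bar>?G q - ?G p\<bar> < e / 2) (nhds p)"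
        using that unfolding continuous_at_eps_delta eventually_nhds_metric dist_real_def
        by (meson half_gt_zero)+
      show "eventually (\<lambda>q. q \<in> S) (nhds p)"
        using assms(1,2) by (rule eventually_nhds_in_open)
    qed
    then obtain d where d: "d > 0"
      "\<And>q. dist q p < d \<Longrightarrow> \<bar>?E q - ?E p\<bar> < e / 2 \<and> \<bar>?G q - ?G p\<bar> < e / 2 \<and> q \<in> S"
      unfolding eventually_nhds_metric by blast
    \<comment> \<open>This size keeps the whole parallelogram within distance \<open>d\<close> of
      \<open>p\<close>; the summand 1 keeps the denominator positive when \<open>v\<close> and
      \<open>w\<close> both vanish.\<close>
    define r where "r = d / (norm v + norm w + 1)"
    have n: "norm v + norm w + 1 > 0" by (meson add_nonneg_pos norm_ge_zero add_nonneg_nonneg zero_less_one)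
    have r: "r > 0" "r * (norm v + norm w) < d"
      using d(1) n by (auto simp: r_def field_simps)
    have near: "dist (p + s *\<^sub>R v + t *\<^sub>R w) p < d" if "0 \<le> s" "s \<le> r" "0 \<le> t" "t \<le> r" for s t
    proof -
      have "norm (s *\<^sub>R v + t *\<^sub>R w) \<le> s * norm v + t * norm w"
        using norm_triangle_ineq[of "s *\<^sub>R v" "t *\<^sub>R w"] that by simp
      also have "\<dots> \<le> r * norm v + r * norm w"
        using that by (intro add_mono mult_right_mono) auto
      finally show ?thesis
        using r(2) by (simp add: dist_norm algebra_simps)
    qed
    have swap: "p + t *\<^sub>R w + s *\<^sub>R v = p + s *\<^sub>R v + t *\<^sub>R w" for s t
      by (simp add: algebra_simps)
    define B where "B = ball p d"
    have B: "q \<in> S" if "q \<in> B" for q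
      using d(2)[of q] that by (simp add: B_def dist_commute)
    have inB: "p + s *\<^sub>R v + t *\<^sub>R w \<in> B" "p + s *\<^sub>R w + t *\<^sub>R v \<in> B"
      if "0 \<le> s" "s \<le> r" "0 \<le> t" "t \<le> r" for s t
      using near[of s t] near[of t s] that unfolding swap by (auto simp: B_def dist_commute)
    obtain s t where st: "0 < s" "s < r" "0 < t" "t < r"
      "f (p + r *\<^sub>R v + r *\<^sub>R w) - f (p + r *\<^sub>R v) - (f (p + r *\<^sub>R w) - f p) =
       r * (r * ?E (p + s *\<^sub>R v + t *\<^sub>R w))"
      by (rule second_difference[OF r(1) inB(1) f[OF B] fv[OF B]])
    obtain s' t' where st': "0 < s'" "s' < r" "0 < t'" "t' < r"
      "f (p + r *\<^sub>R w + r *\<^sub>R v) - f (p + r *\<^sub>R w) - (f (p + r *\<^sub>R v) - f p) =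
       r * (r * ?G (p + s' *\<^sub>R w + t' *\<^sub>R v))"
      by (rule second_difference[OF r(1) inB(2) f[OF B] fv[OF B]])
    \<comment> \<open>The two left-hand sides are one and the same second difference, since the
      corners do not depend on the order of \<open>v\<close> and \<open>w\<close>.\<close>
    have "r * (r * ?E (p + s *\<^sub>R v + t *\<^sub>R w)) = r * (r * ?G (p + t' *\<^sub>R v + s' *\<^sub>R w))"
      using st(5) st'(5) unfolding swap by linarith
    then have "?E (p + s *\<^sub>R v + t *\<^sub>R w) = ?G (p + t' *\<^sub>R v + s' *\<^sub>R w)"
      using r(1) by simp
    moreover have "\<bar>?E (p + s *\<^sub>R v + t *\<^sub>R w) - ?E p\<bar> < e / 2"
      using d(2)[OF near] st by simp
    moreover have "\<bar>?G (p + t' *\<^sub>R v + s' *\<^sub>R w) - ?G p\<bar> < e / 2"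
      using d(2)[OF near] st' by simp
    ultimately show ?thesis by linarith
  qed
  then have "\<bar>?E p - ?G p\<bar> \<le> 0"
    using field_le_epsilon[of "\<bar>?E p - ?G p\<bar>" 0] by simp
  then show ?thesis by simp
qed

section \<open>Vector fields as derivations\<close>

text \<open>\<open>Ck_on\<close> speaks of derivatives in constant directions only. Expanding in the
  basis expresses the derivative along a variable field through these, with the components of the
  field as coefficients.\<close>

lemma frechet_derivative_Basis:
  fixes f :: "'a::euclidean_space \<Rightarrow> 'b::real_normed_vector"
  assumes "f differentiable (at p)"
  shows "frechet_derivative f (at p) v = (\<Sum>b\<in>Basis. (v \<bullet> b) *\<^sub>R frechet_derivative f (at p) b)"
proof -
  have lin: "linear (frechet_derivative f (at p))"
    by (rule linear_frechet_derivative[OF assms])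
  have "frechet_derivative f (at p) v = frechet_derivative f (at p) (\<Sum>b\<in>Basis. (v \<bullet> b) *\<^sub>R b)"
    by (simp add: euclidean_representation)
  then show ?thesis
    by (simp only: linear_sum[OF lin] linear_scale[OF lin])
qed

lemma Ck_on_vf_apply:
  fixes X :: "'a::euclidean_space \<Rightarrow> 'a"
  assumes "open S" "Ck_on k X S" "Ck_on (Suc k) f S"
  shows "Ck_on k (vf_apply X f) S"
proof (rule Ck_on_cong[OF assms(1)])
  show "Ck_on k (\<lambda>p. \<Sum>b\<in>Basis. (X p \<bullet> b) *\<^sub>R frechet_derivative f (at p) b) S"
    by (intro Ck_on_sum[OF assms(1)] Ck_on_scaleR[OF assms(1)]
        Ck_on_bounded_linear[OF assms(1) bounded_linear_inner_left assms(2)]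
        Ck_on_frechet_derivative[OF assms(3)])
  show "(\<Sum>b\<in>Basis. (X p \<bullet> b) *\<^sub>R frechet_derivative f (at p) b) = vf_apply X f p" if "p \<in> S" for p
    unfolding vf_apply_def
    by (rule frechet_derivative_Basis[OF Ck_on_Suc_differentiable[OF assms(3) that], symmetric])
qed

lemma Ck_on_lie_bracket:
  fixes X Y :: "'a::euclidean_space \<Rightarrow> 'a"
  assumes "open S" "Ck_on (Suc k) X S" "Ck_on (Suc k) Y S"
  shows "Ck_on k (lie_bracket X Y) S"
proof (rule Ck_on_cong[OF assms(1)])
  show "Ck_on k (\<lambda>p. vf_apply X Y p - vf_apply Y X p) S"
    by (intro Ck_on_diff[OF assms(1)] Ck_on_vf_apply[OF assms(1)] Ck_on_Suc_mono[OF assms(2)]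
        Ck_on_Suc_mono[OF assms(3)] assms(2,3))
qed (simp add: lie_bracket_def)

lemma vf_apply_eqI: "(f has_derivative D) (at p) \<Longrightarrow> vf_apply X f p = D (X p)"
  unfolding vf_apply_def by (simp add: frechet_derivative_eqI)

lemma vf_apply_add:
  assumes "f differentiable (at p)" "g differentiable (at p)"
  shows "vf_apply X (\<lambda>q. f q + g q) p = vf_apply X f p + vf_apply X g p"
  unfolding vf_apply_eqI[OF has_derivative_add[OF assms[THEN has_derivative_frechet]]]
  by (simp add: vf_apply_def)

lemma vf_apply_diff:
  assumes "f differentiable (at p)" "g differentiable (at p)"
  shows "vf_apply X (\<lambda>q. f q - g q) p = vf_apply X f p - vf_apply X g p"
  unfolding vf_apply_eqI[OF has_derivative_diff[OF assms[THEN has_derivative_frechet]]]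
  by (simp add: vf_apply_def)

lemma vf_apply_mult:
  fixes f g :: "'a::real_normed_vector \<Rightarrow> real"
  assumes "f differentiable (at p)" "g differentiable (at p)"
  shows "vf_apply X (\<lambda>q. f q * g q) p = f p * vf_apply X g p + vf_apply X f p * g p"
  unfolding vf_apply_eqI[OF has_derivative_mult[OF assms[THEN has_derivative_frechet]]]
  by (simp add: vf_apply_def)

lemma vf_apply_cmult:
  fixes f :: "'a::real_normed_vector \<Rightarrow> real"
  assumes "f differentiable (at p)"
  shows "vf_apply X (\<lambda>q. c * f q) p = c * vf_apply X f p"
  unfolding vf_apply_eqI[OF has_derivative_mult_right[OF assms[THEN has_derivative_frechet]]]
  by (simp add: vf_apply_def)

text \<open>The product rule for \<open>Y f\<close>, written as the sum of
  \<open>Y q \<bullet> b\<close> times the derivative of \<open>f\<close> along \<open>b\<close>,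
  separates a first-order term in \<open>f\<close> from the Hessian of \<open>f\<close>. Only the
  first-order term survives in a commutator.\<close>

lemma vf_apply_vf_apply:
  fixes f :: "'a::euclidean_space \<Rightarrow> real"
  assumes "open S" "p \<in> S" "Ck_on 2 f S" "Y differentiable (at p)"
  shows "vf_apply X (vf_apply Y f) p = frechet_derivative f (at p) (vf_apply X Y p) +
    (\<Sum>b\<in>Basis. \<Sum>c\<in>Basis. (Y p \<bullet> b) * (X p \<bullet> c) *
       frechet_derivative (\<lambda>q. frechet_derivative f (at q) b) (at p) c)"
proof -
  have f: "f differentiable (at q)" if "q \<in> S" for q
    by (rule Ck_on_differentiable[OF assms(3) _ that]) simp
  have fv: "(\<lambda>q. frechet_derivative f (at q) v) differentiable (at p)" for v
    using assms(2,3) by (simp add: numeral_2_eq_2)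
  define Y' where "Y' = frechet_derivative Y (at p)"
  have Y': "(Y has_derivative Y') (at p)"
    unfolding Y'_def by (rule has_derivative_frechet[OF assms(4)])
  have "((\<lambda>q. \<Sum>b\<in>Basis. (Y q \<bullet> b) * frechet_derivative f (at q) b) has_derivative
      (\<lambda>v. \<Sum>b\<in>Basis. (Y p \<bullet> b) * frechet_derivative (\<lambda>q. frechet_derivative f (at q) b) (at p) v +
         (Y' v \<bullet> b) * frechet_derivative f (at p) b)) (at p)"
    by (intro has_derivative_sum has_derivative_mult has_derivative_inner_left Y'
        has_derivative_frechet fv)
  note vf_apply_eqI[OF this, of X]
  also have "vf_apply X (\<lambda>q. \<Sum>b\<in>Basis. (Y q \<bullet> b) * frechet_derivative f (at q) b) p =
      vf_apply X (vf_apply Y f) p"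
    by (rule vf_apply_cong_open[OF assms(1,2)])
      (simp only: vf_apply_def frechet_derivative_Basis[OF f, of _ "Y _"] real_scaleR_def)
  finally show ?thesis
    by (simp only: vf_apply_def[of X Y] Y'_def[symmetric] sum.distrib sum_distrib_left mult.assoc
        frechet_derivative_Basis[OF f[OF assms(2)], of "Y' (X p)"]
        frechet_derivative_Basis[OF fv, of _ "X p"] real_scaleR_def add.commute)
qed

lemma vf_apply_lie_bracket:
  fixes f :: "'a::euclidean_space \<Rightarrow> real"
  assumes "open S" "p \<in> S" "Ck_on 2 f S" "X differentiable (at p)" "Y differentiable (at p)"
  shows "vf_apply X (vf_apply Y f) p - vf_apply Y (vf_apply X f) p = vf_apply (lie_bracket X Y) f p"
proof -
  have lin: "linear (frechet_derivative f (at p))"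
    by (rule linear_frechet_derivative[OF Ck_on_differentiable[OF assms(3) _ assms(2)]]) simp
  \<comment> \<open>The Hessian terms of the two orders coincide: exchange the sums, rename the
    indices, and use the symmetry of second derivatives.\<close>
  have "(\<Sum>b\<in>Basis. \<Sum>c\<in>Basis. (Y p \<bullet> b) * (X p \<bullet> c) *
       frechet_derivative (\<lambda>q. frechet_derivative f (at q) b) (at p) c) =
     (\<Sum>c\<in>Basis. \<Sum>b\<in>Basis. (Y p \<bullet> b) * (X p \<bullet> c) *
       frechet_derivative (\<lambda>q. frechet_derivative f (at q) b) (at p) c)"
    by (rule sum.swap)
  also have "\<dots> = (\<Sum>b\<in>Basis. \<Sum>c\<in>Basis. (X p \<bullet> b) * (Y p \<bullet> c) *
       frechet_derivative (\<lambda>q. frechet_derivative f (at q) b) (at p) c)"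
    by (intro sum.cong refl)
      (subst frechet_derivative_commute[OF assms(1-3)], simp only: mult.commute)
  finally show ?thesis
    unfolding vf_apply_vf_apply[OF assms(1-3) assms(4), of Y]
      vf_apply_vf_apply[OF assms(1-3) assms(5), of X]
    by (simp add: vf_apply_def[of "lie_bracket X Y"] lie_bracket_def linear_diff[OF lin])
qed

section \<open>Frames \<open>X, Y, Z\<close> with \<open>[X, Y] = 4 Z\<close>\<close>

text \<open>The structure equations of \<open>H1\<close>, \<open>H2\<close>, \<open>T\<close> with
  coefficients \<open>Phi1\<close>, \<open>Phi2\<close>, detached from complex coordinates. Each
  application of a field costs one order, so C^3 functions and C^2 fields allow the three successive
  derivatives in the invariants.\<close>

locale contact_frame =
  fixes U :: "'a::euclidean_space set" and X Y Z :: "'a \<Rightarrow> 'a" and F G :: "'a \<Rightarrow> real"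
  assumes open_U: "open U"
    and Ck_X: "Ck_on 2 X U" and Ck_Y: "Ck_on 2 Y U" and Ck_Z: "Ck_on 2 Z U"
    and Ck_F: "Ck_on 3 F U" and Ck_G: "Ck_on 3 G U"
    and bracket_XY: "\<And>p. p \<in> U \<Longrightarrow> lie_bracket X Y p = 4 *\<^sub>R Z p"
    and bracket_XZ: "\<And>p. p \<in> U \<Longrightarrow> lie_bracket X Z p = F p *\<^sub>R Z p"
    and bracket_YZ: "\<And>p. p \<in> U \<Longrightarrow> lie_bracket Y Z p = G p *\<^sub>R Z p"
    and Z_nonzero: "\<And>p. p \<in> U \<Longrightarrow> Z p \<noteq> 0"
begin

abbreviation "h \<equiv> vf_apply X"
abbreviation "k \<equiv> vf_apply Y"

lemma Ck_apply:
  assumes "j \<le> 2"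
  shows "Ck_on (Suc j) f U \<Longrightarrow> Ck_on j (h f) U" "Ck_on (Suc j) f U \<Longrightarrow> Ck_on j (k f) U"
    "Ck_on (Suc j) f U \<Longrightarrow> Ck_on j (vf_apply Z f) U"
  using Ck_on_vf_apply[OF open_U Ck_on_mono[OF Ck_X assms]]
    Ck_on_vf_apply[OF open_U Ck_on_mono[OF Ck_Y assms]]
    Ck_on_vf_apply[OF open_U Ck_on_mono[OF Ck_Z assms]] by blast+

lemma differentiable_frame:
  assumes "p \<in> U"
  shows "X differentiable (at p)" "Y differentiable (at p)" "Z differentiable (at p)"
  by (rule Ck_on_differentiable[OF Ck_X _ assms] Ck_on_differentiable[OF Ck_Y _ assms]
      Ck_on_differentiable[OF Ck_Z _ assms], simp)+

text \<open>The bracket relation read as an identity between operators on functions, the form in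
  which it can be iterated; the same is done for the other two brackets.\<close>

lemma commute_XY:
  fixes f :: "'a \<Rightarrow> real"
  assumes "Ck_on 2 f U" "p \<in> U"
  shows "h (k f) p - k (h f) p = 4 * vf_apply Z f p"
proof -
  have f: "f differentiable (at p)"
    by (rule Ck_on_differentiable[OF assms(1) _ assms(2)]) simp
  have "h (k f) p - k (h f) p = vf_apply (lie_bracket X Y) f p"
    by (rule vf_apply_lie_bracket[OF open_U assms(2,1) differentiable_frame(1,2)[OF assms(2)]])
  also have "\<dots> = 4 * vf_apply Z f p"
    by (simp add: vf_apply_def bracket_XY[OF assms(2)] linear_scale[OF linear_frechet_derivative[OF f]])
  finally show ?thesis .
qed

lemma commute_XZ:
  fixes f :: "'a \<Rightarrow> real"
  assumes "Ck_on 2 f U" "p \<in> U"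
  shows "h (vf_apply Z f) p - vf_apply Z (h f) p = F p * vf_apply Z f p"
proof -
  have f: "f differentiable (at p)"
    by (rule Ck_on_differentiable[OF assms(1) _ assms(2)]) simp
  have "h (vf_apply Z f) p - vf_apply Z (h f) p = vf_apply (lie_bracket X Z) f p"
    by (rule vf_apply_lie_bracket[OF open_U assms(2,1) differentiable_frame(1,3)[OF assms(2)]])
  also have "\<dots> = F p * vf_apply Z f p"
    by (simp add: vf_apply_def bracket_XZ[OF assms(2)] linear_scale[OF linear_frechet_derivative[OF f]])
  finally show ?thesis .
qed

lemma commute_YZ:
  fixes f :: "'a \<Rightarrow> real"
  assumes "Ck_on 2 f U" "p \<in> U"
  shows "k (vf_apply Z f) p - vf_apply Z (k f) p = G p * vf_apply Z f p"
proof -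
  have f: "f differentiable (at p)"
    by (rule Ck_on_differentiable[OF assms(1) _ assms(2)]) simp
  have "k (vf_apply Z f) p - vf_apply Z (k f) p = vf_apply (lie_bracket Y Z) f p"
    by (rule vf_apply_lie_bracket[OF open_U assms(2,1) differentiable_frame(2,3)[OF assms(2)]])
  also have "\<dots> = G p * vf_apply Z f p"
    by (simp add: vf_apply_def bracket_YZ[OF assms(2)] linear_scale[OF linear_frechet_derivative[OF f]])
  finally show ?thesis .
qed

lemma Ck_on_1_differentiable: "Ck_on 1 f U \<Longrightarrow> p \<in> U \<Longrightarrow> f differentiable (at p)"
  by (rule Ck_on_differentiable[OF _ zero_less_one])

text \<open>The Jacobi identity for \<open>X, Y, Z\<close>, tested on a linear function \<open>u\<close> with \<open>Z u \<noteq> 0\<close>.\<close>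

lemma XG_eq_YF:
  assumes p: "p \<in> U"
  shows "h G p = k F p"
proof -
  \<comment> \<open>At \<open>p\<close> the derivative of \<open>u\<close> along \<open>Z\<close> is
    the squared norm of \<open>Z p\<close>, so \<open>t p\<close> is nonzero and can be cancelled at
    the end.\<close>
  define u where "u = (\<lambda>q. q \<bullet> Z p)"
  define t where "t = vf_apply Z u"
  have Ck_u: "Ck_on j u U" for j
  proof -
    have "Ck_on j (\<lambda>q::'a. q) U"
    proof (cases j)
      case (Suc i)
      then show ?thesis by (simp add: Ck_on_const)
    qed simp
    then show ?thesis
      unfolding u_def by (rule Ck_on_bounded_linear[OF open_U bounded_linear_inner_left])
  qed
  have Ck_t: "Ck_on 2 t U"
    unfolding t_def by (rule Ck_apply(3)[OF order.refl Ck_u])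
  have Ck_hu: "Ck_on 2 (h u) U" and Ck_ku: "Ck_on 2 (k u) U"
    by (rule Ck_apply[OF order.refl Ck_u])+
  have Ck1: "Ck_on 1 f U \<Longrightarrow> f differentiable (at p)" for f :: "'a \<Rightarrow> real"
    by (rule Ck_on_1_differentiable[OF _ p])
  have two: "Suc 1 = 2" by simp
  note ap = Ck_apply[of 1, unfolded two, OF one_le_numeral]
  have 1: "Ck_on 1 (h t) U" "Ck_on 1 (k t) U" "Ck_on 1 t U"
      "Ck_on 1 (vf_apply Z (h u)) U" "Ck_on 1 (vf_apply Z (k u)) U" "Ck_on 1 F U" "Ck_on 1 G U"
    using ap(1,2)[OF Ck_t] ap(3) Ck_hu Ck_ku Ck_on_mono[OF Ck_F] Ck_on_mono[OF Ck_G] Ck_on_mono[OF Ck_t] by (simp_all del: Ck_on.simps One_nat_def)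
  note d = 1[THEN Ck1]
  \<comment> \<open>The three commutation rules for \<open>u\<close> are differentiated, each along
    the remaining field: \<open>[X, Z]\<close> along \<open>Y\<close>, \<open>[Y, Z]\<close> along
    \<open>X\<close>, and below \<open>[X, Y]\<close> along \<open>Z\<close>. Together these form
    the Jacobi sum.\<close>
  have "k (\<lambda>q. h t q - vf_apply Z (h u) q) p = k (\<lambda>q. F q * t q) p"
    unfolding t_def by (rule vf_apply_cong_open[OF open_U p commute_XZ[OF Ck_u]])
  then have e1: "k (h t) p - k (vf_apply Z (h u)) p = F p * k t p + k F p * t p"
    by (simp only: vf_apply_diff[OF d(1,4)] vf_apply_mult[OF d(6,3)])
  have "h (\<lambda>q. k t q - vf_apply Z (k u) q) p = h (\<lambda>q. G q * t q) p"
    unfolding t_def by (rule vf_apply_cong_open[OF open_U p commute_YZ[OF Ck_u]])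
  then have e2: "h (k t) p - h (vf_apply Z (k u)) p = G p * h t p + h G p * t p"
    by (simp only: vf_apply_diff[OF d(2,5)] vf_apply_mult[OF d(7,3)])
  have "Ck_on 1 (h (k u)) U" "Ck_on 1 (k (h u)) U"
    by (rule ap(1)[OF Ck_ku] ap(2)[OF Ck_hu])+
  note d' = this[THEN Ck1]
  have "vf_apply Z (\<lambda>q. h (k u) q - k (h u) q) p = vf_apply Z (\<lambda>q. 4 * t q) p"
    unfolding t_def by (rule vf_apply_cong_open[OF open_U p commute_XY[OF Ck_u]])
  then have e3: "vf_apply Z (h (k u)) p - vf_apply Z (k (h u)) p = 4 * vf_apply Z t p"
    by (simp only: vf_apply_diff[OF d'] vf_apply_cmult[OF d(3)])
  have e4: "h t p - vf_apply Z (h u) p = F p * t p" "k t p - vf_apply Z (k u) p = G p * t p"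
    unfolding t_def by (rule commute_XZ[OF Ck_u p] commute_YZ[OF Ck_u p])+
  note e5 = commute_XY[OF Ck_t p] commute_XZ[OF Ck_ku p] commute_YZ[OF Ck_hu p]
  \<comment> \<open>Subtracting \<open>e1\<close> from \<open>e2\<close> and using \<open>e3\<close>
    and \<open>e5\<close>, all terms of third order in \<open>u\<close> cancel and
    \<open>(h G p - k F p) * t p\<close> becomes the difference of these two left-hand sides. Both
    equal \<open>F p * G p * t p\<close>. They are prepared here because the rest of the elimination
    is linear.\<close>
  have "F p * (k t p - vf_apply Z (k u) p) = F p * (G p * t p)"
    "G p * (h t p - vf_apply Z (h u) p) = G p * (F p * t p)"
    using e4 by simp_all
  then have "(h G p - k F p) * t p = 0"
    using e1 e2 e3 e5 by (simp add: algebra_simps)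
  moreover have "t p \<noteq> 0"
  proof -
    have "(u has_derivative (\<lambda>v. v \<bullet> Z p)) (at p)"
      unfolding u_def by (intro has_derivative_inner_left has_derivative_ident)
    then show ?thesis
      using Z_nonzero[OF p] by (simp add: t_def vf_apply_eqI)
  qed
  ultimately show ?thesis by simp
qed

text \<open>The left side is \<open>[X, [X, Y]]\<close> applied to \<open>f\<close>. Differentiating
  \<open>[X, Y] f = 4 Z f\<close> along \<open>X\<close> and subtracting the same rule for
  \<open>h f\<close> leaves \<open>4 [X, Z] f\<close>, that is \<open>4 F Z f\<close>. Eliminating
  \<open>Z\<close> gives a relation in \<open>X\<close> and \<open>Y\<close> alone, as the
  invariants contain no derivative along \<open>Z\<close>.\<close>

lemma third_order_X:
  fixes f :: "'a \<Rightarrow> real"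
  assumes "Ck_on 3 f U" and p: "p \<in> U"
  shows "h (h (k f)) p - 2 * h (k (h f)) p + k (h (h f)) p = F p * (h (k f) p - k (h f) p)"
proof -
  have f2: "Ck_on 2 f U"
    by (rule Ck_on_mono[OF assms(1)]) simp
  have three: "Suc 2 = 3" by simp
  note hk2 = Ck_apply[OF order.refl, unfolded three, OF assms(1)]
  have two: "Suc 1 = 2" by simp
  note ap = Ck_apply[of 1, unfolded two, OF one_le_numeral]
  note d = ap(1)[OF hk2(2), THEN Ck_on_1_differentiable, OF p] ap(2)[OF hk2(1), THEN Ck_on_1_differentiable, OF p]
    ap(3)[OF f2, THEN Ck_on_1_differentiable, OF p]
  have "h (\<lambda>q. h (k f) q - k (h f) q) p = h (\<lambda>q. 4 * vf_apply Z f q) p"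
    by (rule vf_apply_cong_open[OF open_U p commute_XY[OF f2]])
  then have "h (h (k f)) p - h (k (h f)) p = 4 * h (vf_apply Z f) p"
    by (simp only: vf_apply_diff[OF d(1,2)] vf_apply_cmult[OF d(3)])
  then show ?thesis
    using commute_XY[OF hk2(1) p] commute_XZ[OF f2 p] commute_XY[OF f2 p] by (simp add: algebra_simps)
qed

text \<open>The counterpart of \<open>third_order_X\<close> for \<open>[Y, [X, Y]]\<close>, obtained
  by differentiating along \<open>Y\<close>.\<close>

lemma third_order_Y:
  fixes f :: "'a \<Rightarrow> real"
  assumes "Ck_on 3 f U" and p: "p \<in> U"
  shows "2 * k (h (k f)) p - k (k (h f)) p - h (k (k f)) p = G p * (h (k f) p - k (h f) p)"
proof -
  have f2: "Ck_on 2 f U"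
    by (rule Ck_on_mono[OF assms(1)]) simp
  have three: "Suc 2 = 3" by simp
  note hk2 = Ck_apply[OF order.refl, unfolded three, OF assms(1)]
  have two: "Suc 1 = 2" by simp
  note ap = Ck_apply[of 1, unfolded two, OF one_le_numeral]
  note d = ap(1)[OF hk2(2), THEN Ck_on_1_differentiable, OF p] ap(2)[OF hk2(1), THEN Ck_on_1_differentiable, OF p]
    ap(3)[OF f2, THEN Ck_on_1_differentiable, OF p]
  have "k (\<lambda>q. h (k f) q - k (h f) q) p = k (\<lambda>q. 4 * vf_apply Z f q) p"
    by (rule vf_apply_cong_open[OF open_U p commute_XY[OF f2]])
  then have "k (h (k f)) p - k (k (h f)) p = 4 * k (vf_apply Z f) p"
    by (simp only: vf_apply_diff[OF d(1,2)] vf_apply_cmult[OF d(3)])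
  then show ?thesis
    using commute_XY[OF hk2(2) p] commute_YZ[OF f2 p] commute_XY[OF f2 p] by (simp add: algebra_simps)
qed

end

section \<open>The real frame of the graph\<close>

locale levi_nondegenerate_graph =
  fixes \<phi> :: "complex \<times> real \<Rightarrow> real" and U :: "(complex \<times> real) set"
  assumes open_U: "open U" and Ck_phi: "Ck_on 6 \<phi> U" and levi_nondegenerate: "levi_nondegenerate_on U \<phi>"
begin

section \<open>Regularity of \<open>A\<close> and of the real frame\<close>

lemma Ck_coef_A: "Ck_on 5 (coef_A \<phi>) U"
proof -
  have "Ck_on (Suc 5) (\<lambda>q. complex_of_real (\<phi> q)) U"
    using Ck_on_bounded_linear[OF open_U bounded_linear_of_real Ck_phi] by (simp del: Ck_on.simps)
  then have D: "Ck_on 5 (\<lambda>p. frechet_derivative (\<lambda>q. complex_of_real (\<phi> q)) (at p) v) U" for v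
    by (rule Ck_on_frechet_derivative)
  have z: "Ck_on 5 (d_z (\<lambda>q. of_real (\<phi> q))) U"
    unfolding d_z_def
    by (rule Ck_on_mult[OF open_U Ck_on_const Ck_on_diff[OF open_U D Ck_on_mult[OF open_U Ck_on_const D]]])
  have u: "Ck_on 5 (\<lambda>p. 1 - \<i> * d_u (\<lambda>q. of_real (\<phi> q)) p) U"
    unfolding d_u_def
    by (rule Ck_on_diff[OF open_U Ck_on_const Ck_on_mult[OF open_U Ck_on_const D]])
  \<comment> \<open>Since \<open>\<phi>\<close> is real, so is its derivative in \<open>u\<close>;
    the denominator therefore has real part 1.\<close>
  have "1 - \<i> * d_u (\<lambda>q. of_real (\<phi> q)) p \<noteq> 0" if "p \<in> U" for p
  proof -
    have "\<phi> differentiable (at p)"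
      by (rule Ck_on_differentiable[OF Ck_phi _ that]) simp
    note D = bounded_linear.has_derivative[OF bounded_linear_of_real has_derivative_frechet[OF this]]
    have "d_u (\<lambda>q. of_real (\<phi> q)) p = of_real (frechet_derivative \<phi> (at p) (0, 1))"
      unfolding d_u_def by (rule fun_cong[OF frechet_derivative_eqI[OF D]])
    then show ?thesis by (simp add: complex_eq_iff)
  qed
  from Ck_on_divide[OF open_U Ck_on_mult[OF open_U Ck_on_const z] u this]
  show ?thesis unfolding coef_A_def[abs_def] .
qed

definition dA where "dA p = frechet_derivative (coef_A \<phi>) (at p)"

lemma has_derivative_coef_A: "p \<in> U \<Longrightarrow> (coef_A \<phi> has_derivative dA p) (at p)"
  unfolding dA_def by (intro has_derivative_frechet Ck_on_differentiable[OF Ck_coef_A]) simp_all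

lemma dA_pair:
  assumes "p \<in> U"
  shows "dA p (v, r) = dA p (v, 0) + of_real r * dA p (0, 1)"
proof -
  have lin: "linear (dA p)"
    using has_derivative_coef_A[OF assms] by (rule has_derivative_linear)
  have "dA p (v, r) = dA p ((v, 0) + r *\<^sub>R (0, 1))" by simp
  then show ?thesis
    by (simp only: linear_add[OF lin] linear_scale[OF lin] scaleR_conv_of_real)
qed

lemma Ck_H1: "Ck_on 5 (H1 \<phi>) U"
proof -
  have "bounded_linear (\<lambda>a. (0 :: complex, 2 * Re a))"
    by (intro bounded_linear_Pair bounded_linear_zero bounded_linear_const_mult bounded_linear_Re)
  from Ck_on_add[OF open_U Ck_on_const[of _ "(1, 0)"] Ck_on_bounded_linear[OF open_U this Ck_coef_A]]
  show ?thesis by (simp del: Ck_on.simps add: H1_def[abs_def])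
qed

lemma Ck_H2: "Ck_on 5 (H2 \<phi>) U"
proof -
  have "bounded_linear (\<lambda>a. (0 :: complex, - 2 * Im a))"
    by (intro bounded_linear_Pair bounded_linear_zero bounded_linear_const_mult bounded_linear_Im)
  from Ck_on_add[OF open_U Ck_on_const[of _ "(\<i>, 0)"] Ck_on_bounded_linear[OF open_U this Ck_coef_A]]
  show ?thesis by (simp del: Ck_on.simps add: H2_def[abs_def])
qed

lemma Ck_T: "Ck_on 4 (T \<phi>) U"
proof -
  have "Ck_on (Suc 4) (H1 \<phi>) U" "Ck_on (Suc 4) (H2 \<phi>) U"
    using Ck_H1 Ck_H2 by (simp_all del: Ck_on.simps)
  from Ck_on_bounded_linear[OF open_U bounded_linear_scaleR_right Ck_on_lie_bracket[OF open_U this]]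
  show ?thesis unfolding T_def[abs_def] .
qed

section \<open>The Levi function as a component of \<open>T\<close>\<close>

lemma has_derivative_H1: "p \<in> U \<Longrightarrow> (H1 \<phi> has_derivative (\<lambda>v. (0, 2 * Re (dA p v)))) (at p)"
  unfolding H1_def[abs_def]
  by (intro has_derivative_Pair has_derivative_const has_derivative_mult_right
      has_derivative_Re has_derivative_coef_A)

lemma has_derivative_H2: "p \<in> U \<Longrightarrow> (H2 \<phi> has_derivative (\<lambda>v. (0, - 2 * Im (dA p v)))) (at p)"
  unfolding H2_def[abs_def]
  by (intro has_derivative_Pair has_derivative_const has_derivative_mult_right
      has_derivative_Im has_derivative_coef_A)

text \<open>By \<open>levi_eq\<close> this is \<open>-\<ell>/2\<close>, a real substitute for the
  complex-valued \<open>levi\<close>.\<close>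

definition t where "t p = snd (T \<phi> p)"

text \<open>The \<open>z\<close>-components of \<open>H1\<close> and \<open>H2\<close> are constant,
  so their bracket points along \<partial>/\<partial>u.\<close>

lemma T_eq: "p \<in> U \<Longrightarrow> T \<phi> p = (0, t p)"
  unfolding t_def T_def lie_bracket_def
  by (simp add: vf_apply_eqI[OF has_derivative_H1] vf_apply_eqI[OF has_derivative_H2])

text \<open>Since \<open>H1 = L + Lbar\<close> and \<open>H2 = \<i> (L - Lbar)\<close>, the bracket
  \<open>[H1, H2]\<close> is \<open>-2 \<i> [L, Lbar]\<close>, while \<open>[L, Lbar]\<close> is
  \<open>-\<i> \<ell>\<close> times \<partial>/\<partial>u. In the proof both sides are expanded in
  the values of \<open>dA p\<close> on the coordinate vectors, which also shows that
  \<open>levi\<close> is real.\<close>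

lemma levi_eq:
  assumes "p \<in> U"
  shows "levi \<phi> p = of_real (- 2 * t p)"
proof -
  have t: "- 2 * t p = Im (dA p (H1 \<phi> p)) + Re (dA p (H2 \<phi> p))"
    unfolding t_def T_def lie_bracket_def
    by (simp add: vf_apply_eqI[OF has_derivative_H1[OF assms]] vf_apply_eqI[OF has_derivative_H2[OF assms]])
  have "((\<lambda>q. cnj (coef_A \<phi> q)) has_derivative (\<lambda>v. cnj (dA p v))) (at p)"
    by (rule has_derivative_cnj[OF has_derivative_coef_A[OF assms]])
  then have Abar: "frechet_derivative (coef_Abar \<phi>) (at p) = (\<lambda>v. cnj (dA p v))"
    unfolding coef_Abar_def[abs_def] by (rule frechet_derivative_eqI)
  show ?thesis
    unfolding t H1_def H2_def dA_pair[OF assms, of 1 "2 * _"] dA_pair[OF assms, of \<i> "- 2 * _"]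
      levi_def d_z_def d_zbar_def d_u_def Abar dA_def[symmetric] coef_Abar_def
    by (simp add: complex_eq_iff algebra_simps)
qed

lemma t_nonzero: "p \<in> U \<Longrightarrow> t p \<noteq> 0"
  using levi_nondegenerate levi_eq[of p] by (auto simp: levi_nondegenerate_on_def)

lemma Ck_t: "Ck_on 4 t U"
  using Ck_on_bounded_linear[OF open_U bounded_linear_snd Ck_T] unfolding t_def[abs_def] .

section \<open>Brackets with \<open>T\<close>, the functions \<open>Phi1\<close> and
  \<open>Phi2\<close>, and their relation to \<open>P\<close>\<close>

definition dt where "dt p = frechet_derivative t (at p)"

lemma has_derivative_t: "p \<in> U \<Longrightarrow> (t has_derivative dt p) (at p)"
  unfolding dt_def by (intro has_derivative_frechet Ck_on_differentiable[OF Ck_t]) simp_all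

lemma dt_pair:
  assumes "p \<in> U"
  shows "dt p (v, r) = dt p (v, 0) + r * dt p (0, 1)"
proof -
  have lin: "linear (dt p)"
    using has_derivative_t[OF assms] by (rule has_derivative_linear)
  have "dt p (v, r) = dt p ((v, 0) + r *\<^sub>R (0, 1))" by simp
  then show ?thesis
    by (simp only: linear_add[OF lin] linear_scale[OF lin] real_scaleR_def)
qed

lemma vf_apply_T:
  assumes "p \<in> U"
  shows "vf_apply V (T \<phi>) p = (0, dt p (V p))"
proof -
  have "vf_apply V (T \<phi>) p = vf_apply V (\<lambda>q. (0, t q)) p"
    by (rule vf_apply_cong_open[OF open_U assms T_eq])
  also have "\<dots> = (0, dt p (V p))"
    by (rule vf_apply_eqI) (intro has_derivative_Pair has_derivative_const has_derivative_t assms)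
  finally show ?thesis .
qed

text \<open>As \<open>T\<close> is \<open>t\<close> times \<partial>/\<partial>u, the
  \<open>u\<close>-component of the bracket is \<open>H1 t - T (2 Re A)\<close>, here written in
  coordinates.\<close>

lemma bracket_H1_T:
  assumes "p \<in> U"
  shows "lie_bracket (H1 \<phi>) (T \<phi>) p =
    (0, dt p (1, 0) + 2 * Re (coef_A \<phi> p) * dt p (0, 1) - 2 * t p * Re (dA p (0, 1)))"
proof -
  have "dA p (0, t p) = of_real (t p) * dA p (0, 1)"
    using dA_pair[OF assms, of 0 "t p"] linear_0[OF has_derivative_linear[OF has_derivative_coef_A[OF assms]]]
    by (simp add: zero_prod_def)
  then show ?thesis
    by (simp add: lie_bracket_def vf_apply_T[OF assms] vf_apply_eqI[OF has_derivative_H1[OF assms]]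
        T_eq[OF assms] H1_def dt_pair[OF assms, of 1 "2 * _"])
qed

lemma bracket_H2_T:
  assumes "p \<in> U"
  shows "lie_bracket (H2 \<phi>) (T \<phi>) p =
    (0, dt p (\<i>, 0) - 2 * Im (coef_A \<phi> p) * dt p (0, 1) + 2 * t p * Im (dA p (0, 1)))"
proof -
  have "dA p (0, t p) = of_real (t p) * dA p (0, 1)"
    using dA_pair[OF assms, of 0 "t p"] linear_0[OF has_derivative_linear[OF has_derivative_coef_A[OF assms]]]
    by (simp add: zero_prod_def)
  then show ?thesis
    by (simp add: lie_bracket_def vf_apply_T[OF assms] vf_apply_eqI[OF has_derivative_H2[OF assms]]
        T_eq[OF assms] H2_def dt_pair[OF assms, of \<i> "- (2 * _)"])
qed

text \<open>Here Levi nondegeneracy enters through \<open>t p \<noteq> 0\<close>: it makes the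
  multiple unique, so the descriptions defining \<open>Phi1\<close> and \<open>Phi2\<close> have the
  expected value.\<close>

lemma the_multiple_of_T:
  assumes "p \<in> U"
  shows "(THE r. (0, s) = r *\<^sub>R T \<phi> p) = s / t p"
  using t_nonzero[OF assms] by (intro the_equality) (auto simp: T_eq[OF assms])

lemma Phi_eq:
  assumes "p \<in> U"
  shows "Phi1 \<phi> p = (dt p (1, 0) + 2 * Re (coef_A \<phi> p) * dt p (0, 1) - 2 * t p * Re (dA p (0, 1))) / t p"
    and "Phi2 \<phi> p = (dt p (\<i>, 0) - 2 * Im (coef_A \<phi> p) * dt p (0, 1) + 2 * t p * Im (dA p (0, 1))) / t p"
  unfolding Phi1_def Phi2_def bracket_H1_T[OF assms] bracket_H2_T[OF assms] the_multiple_of_T[OF assms]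
  by (rule refl)+

lemma bracket_T:
  assumes "p \<in> U"
  shows "lie_bracket (H1 \<phi>) (T \<phi>) p = Phi1 \<phi> p *\<^sub>R T \<phi> p"
    and "lie_bracket (H2 \<phi>) (T \<phi>) p = Phi2 \<phi> p *\<^sub>R T \<phi> p"
  using t_nonzero[OF assms]
  by (simp_all add: bracket_H1_T[OF assms] bracket_H2_T[OF assms] Phi_eq[OF assms] T_eq[OF assms])

text \<open>One order of differentiability goes into \<open>A\<close>, one into \<open>T\<close> and
  one into the brackets with \<open>T\<close>; from C^6 exactly the three orders remain that the
  invariants use. Each function is the \<open>u\<close>-component of its bracket divided by
  \<open>t\<close>.\<close>

lemma Ck_Phi: "Ck_on 3 (Phi1 \<phi>) U" "Ck_on 3 (Phi2 \<phi>) U"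
proof -
  have Suc3: "Ck_on (Suc 3) (H1 \<phi>) U" "Ck_on (Suc 3) (H2 \<phi>) U" "Ck_on (Suc 3) (T \<phi>) U"
    using Ck_on_mono[OF Ck_H1, of 4] Ck_on_mono[OF Ck_H2, of 4] Ck_T by (simp_all del: Ck_on.simps)
  have b: "Ck_on 3 (\<lambda>p. snd (lie_bracket (H1 \<phi>) (T \<phi>) p)) U" "Ck_on 3 (\<lambda>p. snd (lie_bracket (H2 \<phi>) (T \<phi>) p)) U"
    by (rule Ck_on_bounded_linear[OF open_U bounded_linear_snd Ck_on_lie_bracket[OF open_U Suc3(1,3)]]
        Ck_on_bounded_linear[OF open_U bounded_linear_snd Ck_on_lie_bracket[OF open_U Suc3(2,3)]])+
  have t: "Ck_on 3 t U"
    by (rule Ck_on_mono[OF Ck_t]) simp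
  show "Ck_on 3 (Phi1 \<phi>) U"
    by (rule Ck_on_cong[OF open_U _ Ck_on_divide[OF open_U b(1) t t_nonzero]])
      (simp_all add: bracket_H1_T Phi_eq)
  show "Ck_on 3 (Phi2 \<phi>) U"
    by (rule Ck_on_cong[OF open_U _ Ck_on_divide[OF open_U b(2) t t_nonzero]])
      (simp_all add: bracket_H2_T Phi_eq)
qed

text \<open>\<open>P\<close> is \<open>L \<ell> / \<ell> - A_u\<close>, in which the factor -2
  between \<open>\<ell>\<close> and \<open>t\<close> cancels. With
  \<open>Phi1 = H1 t / t - 2 Re A_u\<close> and \<open>Phi2 = H2 t / t + 2 Im A_u\<close> this is
  \<open>(Phi1 - \<i> Phi2) / 2\<close>, and conjugation gives the claim.\<close>

lemma coef_Pbar_eq: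
  assumes "p \<in> U"
  shows "coef_Pbar \<phi> p = Complex (Phi1 \<phi> p / 2) (Phi2 \<phi> p / 2)"
proof -
  have "frechet_derivative (levi \<phi>) (at p) = frechet_derivative (\<lambda>q. of_real (- 2 * t q)) (at p)"
    by (rule frechet_derivative_cong_open[OF open_U assms levi_eq])
  also have "\<dots> = (\<lambda>v. of_real (- 2 * dt p v))"
    by (intro frechet_derivative_eqI has_derivative_of_real has_derivative_mult_right has_derivative_t assms)
  finally have D: "frechet_derivative (levi \<phi>) (at p) = (\<lambda>v. of_real (- 2 * dt p v))" .
  have P: "coef_P \<phi> p = (of_real (dt p (1, 0)) - \<i> * of_real (dt p (\<i>, 0)) - 2 * of_real (t p) * dA p (0, 1)
      + 2 * coef_A \<phi> p * of_real (dt p (0, 1))) / (2 * of_real (t p))"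
    unfolding coef_P_def d_z_def d_u_def D dA_def[symmetric] levi_eq[OF assms]
    using t_nonzero[OF assms] by (simp add: field_simps)
  show ?thesis
    unfolding coef_Pbar_def P Phi_eq[OF assms]
    using t_nonzero[OF assms] by (simp add: complex_eq_iff Re_divide Im_divide field_simps power2_eq_square)
qed

sublocale contact_frame U "H1 \<phi>" "H2 \<phi>" "T \<phi>" "Phi1 \<phi>" "Phi2 \<phi>"
proof
  show "Ck_on 2 (H1 \<phi>) U" "Ck_on 2 (H2 \<phi>) U" "Ck_on 2 (T \<phi>) U"
    using Ck_on_mono[OF Ck_H1, of 2] Ck_on_mono[OF Ck_H2, of 2] Ck_on_mono[OF Ck_T, of 2]
    by (simp_all del: Ck_on.simps)
  show "lie_bracket (H1 \<phi>) (H2 \<phi>) p = 4 *\<^sub>R T \<phi> p" for p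
    by (simp add: T_def)
  show "T \<phi> p \<noteq> 0" if "p \<in> U" for p
    using t_nonzero[OF that] by (simp add: T_eq[OF that] zero_prod_def)
qed (fact open_U Ck_Phi bracket_T)+

end

section \<open>Comparison of the invariants\<close>

lemma vf_apply_Complex:
  assumes "f differentiable (at p)" "g differentiable (at p)"
  shows "(\<lambda>q. Complex (f q) (g q)) differentiable (at p)"
    and "vf_apply V (\<lambda>q. Complex (f q) (g q)) p = Complex (vf_apply V f p) (vf_apply V g p)"
proof -
  have "((\<lambda>q. of_real (f q) + \<i> * of_real (g q)) has_derivative
      (\<lambda>v. of_real (frechet_derivative f (at p) v) + \<i> * of_real (frechet_derivative g (at p) v))) (at p)"
    by (intro has_derivative_add has_derivative_mult_right has_derivative_of_real
        has_derivative_frechet assms)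
  then have D: "((\<lambda>q. Complex (f q) (g q)) has_derivative
      (\<lambda>v. Complex (frechet_derivative f (at p) v) (frechet_derivative g (at p) v))) (at p)"
    by (simp only: Complex_eq)
  show "(\<lambda>q. Complex (f q) (g q)) differentiable (at p)"
    by (rule differentiableI[OF D])
  show "vf_apply V (\<lambda>q. Complex (f q) (g q)) p = Complex (vf_apply V f p) (vf_apply V g p)"
    unfolding vf_apply_eqI[OF D] by (simp add: vf_apply_def)
qed

context levi_nondegenerate_graph
begin

lemma L_cong:
  assumes "p \<in> U" "\<And>q. q \<in> U \<Longrightarrow> f q = g q"
  shows "L \<phi> f p = L \<phi> g p" "Lbar \<phi> f p = Lbar \<phi> g p"
proof -
  have "frechet_derivative f (at p) = frechet_derivative g (at p)"
    by (rule frechet_derivative_cong_open[OF open_U assms(1)]) (rule assms(2))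
  then show "L \<phi> f p = L \<phi> g p" "Lbar \<phi> f p = Lbar \<phi> g p"
    by (simp_all add: L_def Lbar_def d_z_def d_zbar_def d_u_def)
qed

text \<open>Real and imaginary parts of \<open>(h - \<i> k) / 2\<close> and
  \<open>(h + \<i> k) / 2\<close> applied to a complex function. The factor \<open>c\<close>
  collects the powers of 1/2 as the operators are iterated, and \<open>W\<close> is described only
  on \<open>U\<close> so that earlier results of the lemma can be fed back in.\<close>

lemma L_scaled_Complex:
  assumes "p \<in> U" "Ck_on 1 f U" "Ck_on 1 g U"
    and W: "\<And>q. q \<in> U \<Longrightarrow> W q = Complex (c * f q) (c * g q)"
  shows "L \<phi> W p = Complex (c / 2 * (h f p + k g p)) (c / 2 * (h g p - k f p))"
    and "Lbar \<phi> W p = Complex (c / 2 * (h f p - k g p)) (c / 2 * (h g p + k f p))"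
proof -
  note d = Ck_on_1_differentiable[OF assms(2,1)] Ck_on_1_differentiable[OF assms(3,1)]
  have cd: "(\<lambda>q. c * f q) differentiable (at p)" "(\<lambda>q. c * g q) differentiable (at p)"
    using d by (auto intro: differentiable_mult)
  define V where "V = (\<lambda>q. Complex (c * f q) (c * g q))"
  have "V differentiable (at p)"
    unfolding V_def by (rule vf_apply_Complex(1)[OF cd])
  then have "L \<phi> V p = (1/2) * vf_apply (H1 \<phi>) V p - (\<i>/2) * vf_apply (H2 \<phi>) V p \<and>
      Lbar \<phi> V p = (1/2) * vf_apply (H1 \<phi>) V p + (\<i>/2) * vf_apply (H2 \<phi>) V p"
    using real_frame_iff[of p \<phi> "H1 \<phi>" "H2 \<phi>"] by blast
  moreover have "L \<phi> W p = L \<phi> V p" "Lbar \<phi> W p = Lbar \<phi> V p"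
    unfolding V_def by (rule L_cong[OF assms(1) W]; assumption)+
  moreover have "vf_apply X V p = Complex (c * vf_apply X f p) (c * vf_apply X g p)" for X
    unfolding V_def vf_apply_Complex(2)[OF cd] vf_apply_cmult[OF d(1)] vf_apply_cmult[OF d(2)]
    by (rule refl)
  ultimately show "L \<phi> W p = Complex (c / 2 * (h f p + k g p)) (c / 2 * (h g p - k f p))"
    "Lbar \<phi> W p = Complex (c / 2 * (h f p - k g p)) (c / 2 * (h g p + k f p))"
    by (simp_all add: complex_eq_iff field_simps)
qed

lemma complex_invariant_eq_Delta:
  assumes p: "p \<in> U"
  shows "complex_invariant \<phi> p c =
    4 / (c * cnj c ^ 3) * (of_real (Delta1 \<phi> p) + \<i> * of_real (Delta4 \<phi> p))"
proof -
  define F where "F = Phi1 \<phi>"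
  define G where "G = Phi2 \<phi>"
  define Q where "Q = coef_Pbar \<phi>"
  note Ck_F = Ck_Phi(1)[folded F_def] and Ck_G = Ck_Phi(2)[folded G_def]
  have three: "Suc 2 = 3" and two: "Suc 1 = 2" by simp_all
  note ap2 = Ck_apply(1,2)[OF order.refl, unfolded three]
  note ap1 = Ck_apply(1,2)[of 1, unfolded two, OF one_le_numeral]
  note w1 = ap2[OF Ck_F] ap2[OF Ck_G]
  note w2 = w1[THEN ap1(1)] w1[THEN ap1(2)]
  have w1': "Ck_on 1 (h F) U" "Ck_on 1 (k F) U" "Ck_on 1 (h G) U" "Ck_on 1 (k G) U"
    by (rule Ck_on_mono[OF w1(1)] Ck_on_mono[OF w1(2)] Ck_on_mono[OF w1(3)] Ck_on_mono[OF w1(4)], simp)+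
  have F1: "Ck_on 1 F U" and G1: "Ck_on 1 G U"
    by (rule Ck_on_mono[OF Ck_F] Ck_on_mono[OF Ck_G], simp)+
  note d = w2[THEN Ck_on_1_differentiable] w1'[THEN Ck_on_1_differentiable]
  note lin = vf_apply_add vf_apply_diff vf_apply_cmult d

  \<comment> \<open>This relation and its derivatives of the next two orders serve as rewrite rules
    replacing \<open>h G\<close> by \<open>k F\<close>, so that both invariants are compared in the
    same derivatives.\<close>
  have J: "h G q = k F q" if "q \<in> U" for q
    unfolding F_def G_def by (rule XG_eq_YF[OF that])
  have J2: "vf_apply V (h G) q = vf_apply V (k F) q" if "q \<in> U" for q V
    by (rule vf_apply_cong_open[OF open_U that J])
  have J3: "vf_apply W (vf_apply V (h G)) q = vf_apply W (vf_apply V (k F)) q" if "q \<in> U" for q V W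
    by (rule vf_apply_cong_open[OF open_U that J2])

  have Q: "Q q = Complex (1/2 * F q) (1/2 * G q)" if "q \<in> U" for q
    unfolding Q_def F_def G_def coef_Pbar_eq[OF that] by simp
  \<comment> \<open>The imaginary part of \<open>L \<phi> Q\<close> is a multiple of
    \<open>h G - k F\<close> and vanishes by \<open>J\<close>; in \<open>Lbar \<phi> Q\<close> the
    sum \<open>h G + k F\<close> becomes \<open>2 * k F\<close>.\<close>
  have DQ: "L \<phi> Q q = Complex (1/4 * (h F q + k G q)) (1/4 * 0)"
    and D'Q: "Lbar \<phi> Q q = Complex (1/4 * (h F q - k G q)) (1/4 * (2 * k F q))" if "q \<in> U" for q
    using L_scaled_Complex[OF that F1 G1 Q] J[OF that] by simp_all

  \<comment> \<open>On \<open>U\<close>, \<open>4 * L \<phi> Q\<close> is \<open>S\<close> and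
    \<open>4 * Lbar \<phi> Q\<close> is \<open>R + \<i> M\<close>.\<close>
  define S where "S = (\<lambda>q. h F q + k G q)"
  define R where "R = (\<lambda>q. h F q - k G q)"
  define M where "M = (\<lambda>q. 2 * k F q)"
  have Ck_S: "Ck_on 1 S U" and Ck_R: "Ck_on 1 R U" and Ck_M: "Ck_on 1 M U"
    unfolding S_def R_def M_def
    by (rule Ck_on_add[OF open_U w1'(1,4)] Ck_on_diff[OF open_U w1'(1,4)]
        Ck_on_mult[OF open_U Ck_on_const w1'(2)])+
  have vS: "vf_apply V S q = vf_apply V (h F) q + vf_apply V (k G) q"
    and vR: "vf_apply V R q = vf_apply V (h F) q - vf_apply V (k G) q"
    and vM: "vf_apply V M q = 2 * vf_apply V (k F) q" if "q \<in> U" for V q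
    unfolding S_def R_def M_def by (simp_all add: lin that)
  have v0: "vf_apply V (\<lambda>q. 0 :: real) q = 0" for V :: "complex \<times> real \<Rightarrow> complex \<times> real" and q
    by (simp add: vf_apply_def)

  \<comment> \<open>Real and imaginary parts, up to the factor 1/8: \<open>S1\<close>,
    \<open>S2\<close> belong to \<open>Lbar\<close> applied to \<open>L \<phi> Q\<close>, and
    \<open>R1\<close>, \<open>R2\<close> to \<open>L\<close> applied to
    \<open>Lbar \<phi> Q\<close>.\<close>
  define S1 where "S1 = (\<lambda>q. h (h F) q + h (k G) q)"
  define S2 where "S2 = (\<lambda>q. k (h F) q + k (k G) q)"
  define R1 where "R1 = (\<lambda>q. h (h F) q - h (k G) q + 2 * k (k F) q)"
  define R2 where "R2 = (\<lambda>q. 2 * h (k F) q - k (h F) q + k (k G) q)"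
  have D'DQ: "Lbar \<phi> (L \<phi> Q) q = Complex (1/8 * S1 q) (1/8 * S2 q)" if "q \<in> U" for q
    using L_scaled_Complex(2)[OF that Ck_S Ck_on_const, of "L \<phi> Q" "1/4" 0] DQ that
    by (simp add: vS v0 S1_def S2_def S_def[THEN fun_cong])
  have DD'Q: "L \<phi> (Lbar \<phi> Q) q = Complex (1/8 * R1 q) (1/8 * R2 q)" if "q \<in> U" for q
    using L_scaled_Complex(1)[OF that Ck_R Ck_M, of "Lbar \<phi> Q" "1/4"] D'Q that
    by (simp add: vR vM R1_def R2_def R_def[THEN fun_cong] M_def[THEN fun_cong])
  have Ck2: "Ck_on 1 S1 U" "Ck_on 1 S2 U" "Ck_on 1 R1 U" "Ck_on 1 R2 U"
    unfolding S1_def S2_def R1_def R2_def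
    by (intro Ck_on_add[OF open_U] Ck_on_diff[OF open_U] Ck_on_mult[OF open_U] Ck_on_const w2)+
  have v2: "vf_apply V S1 p = vf_apply V (h (h F)) p + vf_apply V (h (k G)) p"
    "vf_apply V S2 p = vf_apply V (k (h F)) p + vf_apply V (k (k G)) p"
    "vf_apply V R1 p = vf_apply V (h (h F)) p - vf_apply V (h (k G)) p + 2 * vf_apply V (k (k F)) p"
    "vf_apply V R2 p = 2 * vf_apply V (h (k F)) p - vf_apply V (k (h F)) p + vf_apply V (k (k G)) p" for V
    unfolding S1_def S2_def R1_def R2_def by (simp_all add: lin p)
  note D'D'DQ = L_scaled_Complex(2)[OF p Ck2(1,2) D'DQ, unfolded v2]
  note D'DD'Q = L_scaled_Complex(2)[OF p Ck2(3,4) DD'Q, unfolded v2]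

  note rel = third_order_X[OF Ck_F p, folded F_def] third_order_X[OF Ck_G p, folded F_def]
    third_order_Y[OF Ck_F p, folded G_def] third_order_Y[OF Ck_G p, folded G_def]
  note rel' = rel[unfolded J2[OF p] J3[OF p]]
  \<comment> \<open>Multiply by 96, so that the brackets in \<open>Delta1\<close> and
    \<open>Delta4\<close> get coefficient 1 on the right. In the real part the third-order terms of
    left minus right are then five times the sum of the left sides of \<open>third_order_X\<close>
    for \<open>G\<close> and \<open>third_order_Y\<close> for \<open>F\<close>. In the imaginary
    part they are four times the left side of \<open>third_order_Y\<close> for \<open>G\<close>
    minus that of \<open>third_order_X\<close> for \<open>F\<close>. The right sides of these
    relations cancel the remaining lower-order terms.\<close>
  have "- (1/3) * Lbar \<phi> (L \<phi> (Lbar \<phi> Q)) p + (2/3) * L \<phi> (Lbar \<phi> Q) p * Q p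
      + (1/2) * Lbar \<phi> (Lbar \<phi> (L \<phi> Q)) p - (7/6) * Lbar \<phi> (L \<phi> Q) p * Q p
      - (1/6) * L \<phi> Q p * Lbar \<phi> Q p + (1/3) * L \<phi> Q p * (Q p)^2
    = 4 * (of_real (Delta1 \<phi> p) + \<i> * of_real (Delta4 \<phi> p))"
    using rel'
    by (simp add: D'D'DQ D'DD'Q D'DQ[OF p] DD'Q[OF p] DQ[OF p] D'Q[OF p] Q[OF p] S1_def S2_def R1_def R2_def
      Delta1_def Delta4_def Let_def F_def[symmetric] G_def[symmetric] J[OF p] J2[OF p] J3[OF p]
      complex_eq_iff power2_eq_square field_simps)
  then show ?thesis
    unfolding complex_invariant_def Let_def Q_def by simp
qed

end

theorem theorem1p1:
  fixes \<phi> :: "complex \<times> real \<Rightarrow> real" and U :: "(complex \<times> real) set"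
  assumes "open U" and "0 \<in> U"
    and "Ck_on 6 \<phi> U"
    and "(\<lambda>p. \<phi> p - (cmod (fst p))\<^sup>2) \<in> O[nhds 0](\<lambda>p. norm p ^ 3)"
    and "levi_nondegenerate_on U \<phi>"
  shows "\<forall>p\<in>U. \<forall>c::complex. c \<noteq> 0 \<longrightarrow>
    complex_invariant \<phi> p c =
      4 / (c * cnj c ^ 3) * (of_real (Delta1 \<phi> p) + \<i> * of_real (Delta4 \<phi> p))"
proof -
  interpret levi_nondegenerate_graph \<phi> U
    by (rule levi_nondegenerate_graph.intro) (fact assms)+
  show ?thesis
    using complex_invariant_eq_Delta by blast
qed

end
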